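(* For all $x\in\mathbb{R}\setminus\{0\}$: a) $\operatorname{sMutInf}_x$ has exactly one extremum, located at the origin $(y,z)=(0,0)$ (a maximum if $x>0$, a minimum if $x<0$). b) $\lim_{\|(y,z)\|\to\infty}\operatorname{sMutInf}_x(y,z)=0$. Moreover: c) For every $(y,z)\in\mathbb{R}^2$, $$\lim_{x\to\pm\infty}\operatorname{sMutInf}_x(y,z)=\pm\left(\log_2(e^{y\pm z}+1)-\frac{e^{y\pm z}}{e^{y\pm z}+1}\log_2e^{y\pm z}\right).$$ Thus $\operatorname{sMutInf}_x\to\pm1$ for $y=\mp z$ and $x\to\pm\infty$ respectively. d) $\operatorname{sMutInf}$ (in the coordinates $(x,y,z)$) can be continuously extended to $\bar{\mathbb{R}}^3$ except for the vertices $V_b$, i.e. to $\bar{\mathbb{R}}^3\setminus V_b$. e) $\operatorname{sMutInf}$ (as a function on $\mathbb{T}$) can be continuously extended to all of $\overline{\mathbb{T}}$.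
   Context: $\mathbb{T}$ is the set of real $2\times2$ matrices $t=\begin{pmatrix}p_{00}&p_{01}\\ p_{10}&p_{11}\end{pmatrix}$ with all $p_{ij}>0$ and $\sum_{i,j}p_{ij}=1$; $p_{i.}=p_{i0}+p_{i1}$, $p_{.j}=p_{0j}+p_{1j}$. $\overline{\mathbb{T}}$ is its closure (all $p_{ij}\ge0$). The mutual information is $\operatorname{MutInf}=\sum_{i,j}p_{ij}\log_2p_{ij}-\sum_ip_{i.}\log_2p_{i.}-\sum_jp_{.j}\log_2p_{.j}$, and $\operatorname{sMutInf}=\operatorname{sign}(D)\cdot\operatorname{MutInf}$ with $D=p_{00}p_{11}-p_{01}p_{10}$. Margin transformation coordinates on $\mathbb{T}$ are given by the diffeomorphism $\Psi:\mathbb{R}^3\to\mathbb{T}$, $\Psi(x,y,z)=\frac{1}{e^{x+y+z}+e^x+e^y+e^z}\begin{pmatrix}e^{x+y+z}&e^y\\ e^z&e^x\end{pmatrix}$; for fixed $x$, $\operatorname{sMutInf}_x(y,z)=\operatorname{sMutInf}(\Psi(x,y,z))$ (the margin weighting function). $\bar{\mathbb{R}}=\mathbb{R}\cup\{-\infty,+\infty\}$ is the two-point compactification, $\bar{\mathbb{R}}^3$ the resulting cube; writing $\pm$ for $\pm\infty$, $V_b=\{(---),(-++),(+-+),(++-)\}$. *)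

theory Defs
  imports "HOL-Analysis.Analysis"
begin

text \<open>
  In the two-element index type \<^typ>\<open>2\<close> the elements are \<open>0\<close> and \<open>1\<close> (and \<open>2 = 0\<close>),
  so the entries \<open>p\<^sub>i\<^sub>j\<close> with \<open>i, j \<in> {0, 1}\<close> are literally \<open>t $ i $ j\<close>.
\<close>

definition tables :: "(real ^ 2 ^ 2) set" where
  "tables = {t. (\<forall>i j. t $ i $ j > 0) \<and> (\<Sum>i\<in>UNIV. \<Sum>j\<in>UNIV. t $ i $ j) = 1}"

definition row_margin :: "real ^ 2 ^ 2 \<Rightarrow> 2 \<Rightarrow> real" where
  "row_margin t i = t $ i $ 0 + t $ i $ 1"

definition col_margin :: "real ^ 2 ^ 2 \<Rightarrow> 2 \<Rightarrow> real" where
  "col_margin t j = t $ 0 $ j + t $ 1 $ j"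

definition MutInf :: "real ^ 2 ^ 2 \<Rightarrow> real" where
  "MutInf t =
     (\<Sum>i\<in>UNIV. \<Sum>j\<in>UNIV. t $ i $ j * log 2 (t $ i $ j))
     - (\<Sum>i\<in>UNIV. row_margin t i * log 2 (row_margin t i))
     - (\<Sum>j\<in>UNIV. col_margin t j * log 2 (col_margin t j))"

definition sMutInf :: "real ^ 2 ^ 2 \<Rightarrow> real" where
  "sMutInf t = sgn (t $ 0 $ 0 * t $ 1 $ 1 - t $ 0 $ 1 * t $ 1 $ 0) * MutInf t"

definition Psi :: "real \<times> real \<times> real \<Rightarrow> real ^ 2 ^ 2" where
  "Psi = (\<lambda>(x, y, z).
     (1 / (exp (x + y + z) + exp x + exp y + exp z)) *\<^sub>R
     (\<chi> i j. if i = 0 then (if j = 0 then exp (x + y + z) else exp y)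
                       else (if j = 0 then exp z else exp x)))"

definition sMutInf_at :: "real \<Rightarrow> real \<times> real \<Rightarrow> real" where
  "sMutInf_at x = (\<lambda>(y, z). sMutInf (Psi (x, y, z)))"

definition local_max_at :: "('a::topological_space \<Rightarrow> real) \<Rightarrow> 'a \<Rightarrow> bool" where
  "local_max_at f p \<longleftrightarrow> (\<forall>\<^sub>F q in nhds p. f q \<le> f p)"

definition local_min_at :: "('a::topological_space \<Rightarrow> real) \<Rightarrow> 'a \<Rightarrow> bool" where
  "local_min_at f p \<longleftrightarrow> (\<forall>\<^sub>F q in nhds p. f p \<le> f q)"

definition local_extremum_at :: "('a::topological_space \<Rightarrow> real) \<Rightarrow> 'a \<Rightarrow> bool" where
  "local_extremum_at f p \<longleftrightarrow> local_max_at f p \<or> local_min_at f p"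

text \<open>
  The two-point compactification of the reals is \<^typ>\<open>ereal\<close> with its order topology; the cube
  is the threefold product.
\<close>

definition V_b :: "(ereal \<times> ereal \<times> ereal) set" where
  "V_b = {(-\<infinity>, -\<infinity>, -\<infinity>), (-\<infinity>, \<infinity>, \<infinity>), (\<infinity>, -\<infinity>, \<infinity>), (\<infinity>, \<infinity>, -\<infinity>)}"

end

theory Submission
  imports Defs
begin

text \<open>
  With \<open>x > 0\<close> and \<open>z\<close> fixed, the two conditional row distributions, with log-odds
  \<open>z + x\<close> and \<open>z - x\<close>, do not depend on \<open>y\<close>. Hence \<open>\<partial>/\<partial>y = 0\<close> says that the column log-odds \<open>z + \<phi>(y)\<close>
  equal a certain odd function \<open>M(z)\<close>, where \<open>\<phi>\<close> is odd with the sign of its argument.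
  For \<open>z > 0\<close> one has \<open>z - \<phi>(z) < M(z) < z\<close>, so that \<open>y < 0\<close> and \<open>\<phi>(y) + \<phi>(z) > 0\<close>.
  Applying this with \<open>y\<close> and \<open>z\<close> exchanged gives the opposite sign of \<open>\<phi>(y) + \<phi>(z)\<close>, so the origin is
  the only critical point. As the function is positive at the origin and tends to \<open>0\<close> at infinity,
  its maximum is attained, and it must be attained there. Exchanging the columns
  reduces \<open>x < 0\<close> to \<open>x > 0\<close>.

  On the closed simplex \<^const>\<open>MutInf\<close> is continuous and vanishes where the determinant does, so
  \<^const>\<open>sMutInf\<close> is continuous there; all limits follow by rewriting \<^const>\<open>Psi\<close> as a rational map of
  logistic coordinates.
\<close>

subsection \<open>The binary entropy\<close>

text \<open>Since \<open>ln 0 = 0\<close>, the formula is already the continuous extension of t ln t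
  to 0, so zero entries of a table need no separate case.\<close>

definition xlnx :: "real \<Rightarrow> real" where
  "xlnx t = t * ln t"

lemma xlnx_0 [simp]: "xlnx 0 = 0"
  by (simp add: xlnx_def)

text \<open>At 0 the right-hand limit turns into that of \<open>- (ln s / s)\<close> at infinity on
  inverting the argument; the left-hand one follows because \<open>ln\<close> is even, which makes
  \<open>xlnx\<close> odd.\<close>

lemma isCont_xlnx: "isCont xlnx t"
proof (cases "t = 0")
  case True
  have "((\<lambda>s::real. - (ln s / s)) \<longlongrightarrow> - 0) at_top"
    by (intro tendsto_minus ln_x_over_x_tendsto_0)
  moreover have "- (ln s / s) = xlnx (inverse s)" for s
    by (cases "s = 0") (simp_all add: xlnx_def inverse_eq_divide ln_div)
  ultimately have right: "(xlnx \<longlongrightarrow> 0) (at_right 0)"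
    by (simp add: filterlim_at_right_to_top)
  have "((\<lambda>s. - xlnx s) \<longlongrightarrow> - 0) (at_right 0)"
    by (intro tendsto_minus right)
  then have "(xlnx \<longlongrightarrow> 0) (at_left 0)"
    by (simp add: filterlim_at_left_to_right xlnx_def ln_minus)
  then show ?thesis
    using right True by (simp add: isCont_def filterlim_split_at)
next
  case False
  then show ?thesis
    unfolding xlnx_def by (intro continuous_intros)
qed

lemma continuous_on_xlnx [continuous_intros]:
  "continuous_on S f \<Longrightarrow> continuous_on S (\<lambda>s. xlnx (f s))"
  using continuous_on_compose2[of UNIV xlnx S f] isCont_xlnx
  by (simp add: continuous_at_imp_continuous_on)

lemma xlnx_mult: "xlnx (a * b) = b * xlnx a + a * xlnx b"
  by (simp add: xlnx_def ln_mult algebra_simps)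

lemma DERIV_xlnx [derivative_intros]:
  "(f has_real_derivative f') (at t) \<Longrightarrow> 0 < f t \<Longrightarrow>
    ((\<lambda>s. xlnx (f s)) has_real_derivative (ln (f t) + 1) * f') (at t)"
  unfolding xlnx_def by (auto intro!: derivative_eq_intros simp: field_simps)

definition entropy2 :: "real \<Rightarrow> real" where
  "entropy2 p = - xlnx p - xlnx (1 - p)"

lemma entropy2_flip: "entropy2 (1 - p) = entropy2 p"
  by (simp add: entropy2_def)

text \<open>Gibbs' inequality against the uniform distribution: use ln u \<le> u - 1 at u = 1/(2q)
  for q = p and q = 1 - p. The remainders 1/2 - q cancel, and equality would force u = 1, that is p
  = 1/2.\<close>

lemma entropy2_less_ln_2:
  assumes "0 < p" "p < 1" "p \<noteq> 1/2"
  shows "entropy2 p < ln 2"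
proof -
  have aux: "- xlnx q \<le> q * ln 2 + (1/2 - q)" if "0 < q" for q
  proof -
    have "ln (1 / (2 * q)) \<le> 1 / (2 * q) - 1"
      using that by (intro ln_le_minus_one) auto
    then have "q * ln (1 / (2 * q)) \<le> q * (1 / (2 * q) - 1)"
      using that by (intro mult_left_mono) auto
    then show ?thesis
      using that by (simp add: xlnx_def ln_div ln_mult algebra_simps)
  qed
  have strict: "- xlnx p < p * ln 2 + (1/2 - p)"
  proof -
    have "ln (1 / (2 * p)) < 1 / (2 * p) - 1"
    proof (rule ccontr)
      assume "\<not> ?thesis"
      moreover have "ln (1 / (2 * p)) \<le> 1 / (2 * p) - 1"
        using assms by (intro ln_le_minus_one) auto
      ultimately have "1 / (2 * p) = 1"
        using assms by (intro ln_eq_minus_one) auto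
      then show False using assms by (auto simp: field_simps)
    qed
    then have "p * ln (1 / (2 * p)) < p * (1 / (2 * p) - 1)"
      using assms by (intro mult_strict_left_mono) auto
    then show ?thesis
      using assms by (simp add: xlnx_def ln_div ln_mult algebra_simps)
  qed
  show ?thesis
    using strict aux[of "1 - p"] assms by (simp add: entropy2_def algebra_simps)
qed

section \<open>The logistic function and its log-odds\<close>

lemma one_plus_exp_pos [simp]: "0 < 1 + exp (t::real)" "1 + exp t \<noteq> 0"
  using exp_gt_zero[of t] by linarith+

lemma exp_plus_exp_pos [simp]: "0 < exp s + exp (t::real)" "exp s + exp t \<noteq> 0"
  using exp_gt_zero[of s] exp_gt_zero[of t] by linarith+

definition logistic :: "real \<Rightarrow> real" where
  "logistic t = exp t / (1 + exp t)"

lemma logistic_pos: "0 < logistic t" and logistic_less_1: "logistic t < 1"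
  by (simp_all add: logistic_def)

lemma logistic_minus: "logistic (- t) = 1 - logistic t"
  by (simp add: logistic_def exp_minus field_simps)

lemma logistic_0: "logistic 0 = 1/2"
  by (simp add: logistic_def)

lemma DERIV_logistic [derivative_intros]:
  assumes "(f has_real_derivative f') (at t)"
  shows "((\<lambda>s. logistic (f s)) has_real_derivative
      logistic (f t) * (1 - logistic (f t)) * f') (at t)"
  unfolding logistic_def
  by (auto intro!: derivative_eq_intros assms simp: field_simps power2_eq_square)

lemma continuous_on_logistic [continuous_intros]:
  "continuous_on S f \<Longrightarrow> continuous_on S (\<lambda>s. logistic (f s))"
  unfolding logistic_def by (intro continuous_intros) auto

lemma logistic_strict_mono: "s < t \<Longrightarrow> logistic s < logistic t"
  by (simp add: logistic_def field_simps)

lemma logistic_less_iff: "logistic s < logistic t \<longleftrightarrow> s < t"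
  by (metis logistic_strict_mono linorder_neqE_linordered_idom order_less_asym)

text \<open>The argument of \<open>logistic\<close> is the log-odds of its value; hence the
  derivative of \<open>entropy2\<close> at \<open>logistic t\<close> is simply
  \<open>- t\<close>.\<close>

lemma ln_one_minus_logistic: "ln (1 - logistic t) = ln (logistic t) - t"
proof -
  have "1 - logistic t = logistic t * exp (- t)"
    by (simp add: logistic_def exp_minus field_simps)
  then show ?thesis
    using logistic_pos[of t] by (simp add: ln_mult)
qed

lemma tendsto_logistic_at_bot: "(logistic \<longlongrightarrow> 0) at_bot"
proof -
  have "((\<lambda>t::real. exp t / (1 + exp t)) \<longlongrightarrow> 0 / (1 + 0 :: real)) at_bot"
    by (intro tendsto_intros exp_at_bot) simp
  then show ?thesis
    by (simp add: logistic_def[abs_def])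
qed

lemma tendsto_logistic_at_top: "(logistic \<longlongrightarrow> 1) at_top"
proof -
  have "((\<lambda>t. 1 - logistic t) \<longlongrightarrow> 1 - 0) at_bot"
    by (intro tendsto_intros tendsto_logistic_at_bot)
  then show ?thesis
    by (simp add: filterlim_at_bot_mirror logistic_minus)
qed

lemma DERIV_entropy2 [derivative_intros]:
  assumes "(f has_real_derivative f') (at t)" "0 < f t" "f t < 1"
  shows "((\<lambda>s. entropy2 (f s)) has_real_derivative (ln (1 - f t) - ln (f t)) * f') (at t)"
  unfolding entropy2_def
  using assms by (auto intro!: derivative_eq_intros simp: algebra_simps)

subsection \<open>The critical point equation\<close>

text \<open>The row log-odds of \<^term>\<open>Psi (x, y, z)\<close> are \<^term>\<open>y + margin_shift x z\<close>, the column
  log-odds are \<^term>\<open>z + margin_shift x y\<close>.\<close>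

definition margin_shift :: "real \<Rightarrow> real \<Rightarrow> real" where
  "margin_shift x z = ln (1 + exp (x + z)) - ln (exp x + exp z)"

lemma margin_shift_minus: "margin_shift x (- z) = - margin_shift x z"
proof -
  have *: "1 + exp (x + - z) = exp (- z) * (exp x + exp z)"
    "exp x + exp (- z) = exp (- z) * (1 + exp (x + z))"
    by (simp_all add: algebra_simps flip: exp_add)
  show ?thesis
    unfolding margin_shift_def * by (simp add: ln_mult)
qed

lemma margin_shift_neg_iff:
  assumes "0 < x"
  shows "margin_shift x z < 0 \<longleftrightarrow> z < 0"
proof -
  have "margin_shift x z < 0 \<longleftrightarrow> 1 + exp (x + z) < exp x + exp z"
    by (simp add: margin_shift_def)
  also have "\<dots> \<longleftrightarrow> (exp x - 1) * (exp z - 1) < 0"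
    by (simp add: algebra_simps exp_add)
  also have "\<dots> \<longleftrightarrow> z < 0"
    using assms by (simp add: mult_less_0_iff)
  finally show ?thesis .
qed

text \<open>Given row 0 or row 1 of \<open>Psi (x, y, z)\<close>, column 0 has conditional
  probability \<open>logistic (z + x)\<close> or \<open>logistic (z - x)\<close>. The width is the
  difference of these probabilities, the gap below that of the conditional entropies, in the
  opposite order.\<close>

definition channel_width :: "real \<Rightarrow> real \<Rightarrow> real" where
  "channel_width x z = logistic (z + x) - logistic (z - x)"

definition entropy_gap :: "real \<Rightarrow> real \<Rightarrow> real" where
  "entropy_gap x z = entropy2 (logistic (z - x)) - entropy2 (logistic (z + x))"

lemma channel_width_pos: "0 < x \<Longrightarrow> 0 < channel_width x z"
  by (simp add: channel_width_def logistic_less_iff)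

lemma channel_width_minus: "channel_width x (- z) = channel_width x z"
  using logistic_minus[of "z - x"] logistic_minus[of "z + x"] by (simp add: channel_width_def)

lemma entropy_gap_minus: "entropy_gap x (- z) = - entropy_gap x z"
  using logistic_minus[of "z - x"] logistic_minus[of "z + x"]
  by (simp add: entropy_gap_def entropy2_flip)

text \<open>Let the channel parameter s grow from 0, where both sides vanish, to \<open>x\<close>:
  the difference has derivative s (q(1 - q) - p(1 - p)), which is positive because p is farther from
  1/2 than q.\<close>

lemma entropy_gap_upper:
  assumes "0 < x" "0 < z"
  shows "entropy_gap x z < channel_width x z * z"
proof -
  define f where "f = (\<lambda>s. channel_width s z * z - entropy_gap s z)"
  have "f 0 < f x"
  proof (rule DERIV_pos_imp_increasing_open[OF \<open>0 < x\<close>])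
    fix s assume s: "0 < s" "s < x"
    define p q where "p = logistic (z + s)" and "q = logistic (z - s)"
    have "q < p" "1 - q < p"
      using s assms by (auto simp: p_def q_def logistic_less_iff simp flip: logistic_minus)
    \<comment> \<open>This product equals q(1 - q) - p(1 - p).\<close>
    then have "0 < (p - q) * (p + q - 1)"
      by simp
    then have "0 < q * (1 - q) - p * (1 - p)"
      by (simp add: algebra_simps)
    then have "0 < s * (q * (1 - q) - p * (1 - p))"
      using s by simp
    moreover have "(f has_real_derivative s * (q * (1 - q) - p * (1 - p))) (at s)"
      unfolding f_def channel_width_def entropy_gap_def p_def q_def
      by (auto intro!: derivative_eq_intros simp: logistic_pos logistic_less_1
          ln_one_minus_logistic algebra_simps)
    ultimately show "\<exists>y. (f has_real_derivative y) (at s) \<and> 0 < y"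
      by blast
  next
    show "continuous_on {0..x} f"
      unfolding f_def channel_width_def entropy_gap_def entropy2_def
      by (intro continuous_intros)
  qed
  then show ?thesis
    by (simp add: f_def channel_width_def entropy_gap_def)
qed

text \<open>Monotonicity of u ln(1 + s/u) in u, obtained by differentiating in s for two fixed
  values of u: the derivatives u/(u + s) are ordered, and both functions vanish at s = 0.\<close>

lemma mult_ln_ratio_strict_mono:
  fixes u q s :: real
  assumes "0 < u" "u < q" "0 < s"
  shows "u * ln ((u + s) / u) < q * ln ((q + s) / q)"
proof -
  define f where "f = (\<lambda>s. q * ln (q + s) - u * ln (u + s))"
  have "f 0 < f s"
  proof (rule DERIV_pos_imp_increasing_open[OF \<open>0 < s\<close>])
    fix r assume r: "0 < r" "r < s"
    have "(f has_real_derivative q / (q + r) - u / (u + r)) (at r)"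
      unfolding f_def using r assms by (auto intro!: derivative_eq_intros)
    moreover have "u / (u + r) < q / (q + r)"
      using r assms by (simp add: field_simps)
    ultimately show "\<exists>y. (f has_real_derivative y) (at r) \<and> 0 < y"
      by (metis diff_gt_0_iff_gt)
  next
    show "continuous_on {0..s} f"
      unfolding f_def using assms by (intro continuous_intros) auto
  qed
  then show ?thesis
    using assms by (simp add: f_def ln_div algebra_simps)
qed

text \<open>The left factor \<open>z - margin_shift x z\<close> is ln(p/(1 - q)). After substitution
  the difference of the two sides becomes q ln(p/q) - (1 - p) ln((1 - q)/(1 - p)); both logarithms
  have numerator exceeding denominator by p - q, and 1 - p < q, so the preceding monotonicity
  applies.\<close>

lemma entropy_gap_lower:
  assumes "0 < x" "0 < z"
  shows "channel_width x z * (z - margin_shift x z) < entropy_gap x z"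
proof -
  define p q where "p = logistic (z + x)" and "q = logistic (z - x)"
  have pq: "0 < q" "q < p" "p < 1" "1 - p < q"
    using assms by (auto simp: p_def q_def logistic_pos logistic_less_1 logistic_less_iff
        simp flip: logistic_minus)
  have "1 - q = exp x / (exp x + exp z)"
    by (simp add: q_def logistic_def exp_minus field_simps flip: logistic_minus exp_add)
  then have "ln p - ln (1 - q) = z - margin_shift x z"
    by (simp add: p_def logistic_def margin_shift_def ln_div add.commute)
  moreover have "(1 - p) * ln (((1 - p) + (p - q)) / (1 - p)) < q * ln ((q + (p - q)) / q)"
    using pq by (intro mult_ln_ratio_strict_mono) auto
  then have "(p - q) * (ln p - ln (1 - q)) < entropy2 q - entropy2 p"
    using pq by (simp add: ln_div entropy2_def xlnx_def algebra_simps)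
  ultimately show ?thesis
    by (simp add: entropy_gap_def channel_width_def p_def q_def)
qed

text \<open>Up to a positive factor, the two sides differ by the partial derivative in \<open>y\<close>.\<close>

definition balanced :: "real \<Rightarrow> real \<Rightarrow> real \<Rightarrow> bool" where
  "balanced x y z \<longleftrightarrow> entropy_gap x z = channel_width x z * (z + margin_shift x y)"

lemma balanced_minus: "balanced x (- y) (- z) \<longleftrightarrow> balanced x y z"
  by (auto simp: balanced_def entropy_gap_minus channel_width_minus margin_shift_minus algebra_simps)

text \<open>The two gap bounds squeeze the column log-odds \<open>z + margin_shift x y\<close>
  strictly between \<open>z - margin_shift x z\<close> and \<open>z\<close>.\<close>

lemma balanced_pos:
  assumes "0 < x" "balanced x y z" "0 < z"
  shows "y < 0" "- margin_shift x z < margin_shift x y"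
proof -
  note W = channel_width_pos[OF \<open>0 < x\<close>, of z]
  have "channel_width x z * (z + margin_shift x y) < channel_width x z * z"
    using entropy_gap_upper[of x z] assms by (simp add: balanced_def)
  then have "z + margin_shift x y < z"
    using W by (simp only: mult_less_cancel_left_pos)
  then show "y < 0"
    using margin_shift_neg_iff[OF \<open>0 < x\<close>] by simp
  have "channel_width x z * (z - margin_shift x z) < channel_width x z * (z + margin_shift x y)"
    using entropy_gap_lower[of x z] assms by (simp add: balanced_def)
  then have "z - margin_shift x z < z + margin_shift x y"
    using W by (simp only: mult_less_cancel_left_pos)
  then show "- margin_shift x z < margin_shift x y"
    by simp
qed

lemma balanced_neg:
  assumes "0 < x" "balanced x y z" "z < 0"
  shows "0 < y" "margin_shift x y < - margin_shift x z"
  using balanced_pos[of x "- y" "- z"] assms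
  by (simp_all add: balanced_minus margin_shift_minus)

text \<open>If z > 0, the first equation gives y < 0 and a positive sum of the two shifts; the
  second, now with y < 0, makes the same sum negative. The hypotheses are symmetric, so exchanging
  the variables also yields y = 0.\<close>

lemma balanced_both_imp_eq_0:
  assumes x: "0 < x" and b: "balanced x y z" "balanced x z y"
  shows "z = 0"
proof (rule linorder_cases[of z 0])
  assume "0 < z"
  with balanced_pos[OF x b(1)] balanced_neg[OF x b(2)] show ?thesis
    by force
next
  assume "z < 0"
  with balanced_neg[OF x b(1)] balanced_pos[OF x b(2)] show ?thesis
    by force
qed

subsection \<open>Mutual information of a table\<close>

definition table2 :: "real \<Rightarrow> real \<Rightarrow> real \<Rightarrow> real \<Rightarrow> real ^ 2 ^ 2" where
  "table2 a b c d = (\<chi> i j. if i = 0 then (if j = 0 then a else b) else (if j = 0 then c else d))"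

lemma table2_nth [simp]:
  "table2 a b c d $ 0 $ 0 = a" "table2 a b c d $ 0 $ 1 = b"
  "table2 a b c d $ 1 $ 0 = c" "table2 a b c d $ 1 $ 1 = d"
  by (simp_all add: table2_def)

lemma scaleR_table2: "k *\<^sub>R table2 a b c d = table2 (k * a) (k * b) (k * c) (k * d)"
  by (simp add: table2_def vec_eq_iff)

lemma sum_UNIV_2: "(\<Sum>i\<in>UNIV. f i) = f 0 + f (1::2)"
proof -
  have "(2::2) = 0" by simp
  then show ?thesis by (simp only: sum_2 add.commute)
qed

lemma all_2_iff: "(\<forall>i. P i) \<longleftrightarrow> P 0 \<and> P (1::2)"
proof -
  have "(2::2) = 0" by simp
  then show ?thesis by (simp only: forall_2 conj_commute)
qed

lemma MutInf_eq_xlnx: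
  "MutInf t =
    (xlnx (t $ 0 $ 0) + xlnx (t $ 0 $ 1) + xlnx (t $ 1 $ 0) + xlnx (t $ 1 $ 1)
     - xlnx (t $ 0 $ 0 + t $ 0 $ 1) - xlnx (t $ 1 $ 0 + t $ 1 $ 1)
     - xlnx (t $ 0 $ 0 + t $ 1 $ 0) - xlnx (t $ 0 $ 1 + t $ 1 $ 1)) / ln 2"
  by (simp add: MutInf_def sum_UNIV_2 row_margin_def col_margin_def log_def xlnx_def
      add_divide_distrib diff_divide_distrib)

lemma sMutInf_table2_swap_columns:
  "sMutInf (table2 b a d c) = - sMutInf (table2 a b c d)"
proof -
  have "b * c - a * d = - (a * d - b * c)" by simp
  then have "sgn (b * c - a * d) = - sgn (a * d - b * c)" by (metis sgn_minus)
  moreover have "MutInf (table2 b a d c) = MutInf (table2 a b c d)"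
    by (simp add: MutInf_eq_xlnx add_ac)
  ultimately show ?thesis
    by (simp add: sMutInf_def)
qed

lemma sMutInf_table2_transpose:
  "sMutInf (table2 a c b d) = sMutInf (table2 a b c d)"
  by (simp add: sMutInf_def MutInf_eq_xlnx algebra_simps)

text \<open>Read the table as a binary channel with input probability \<open>r\<close> and conditional output
  probabilities \<open>p\<close>, \<open>q\<close>; along \<open>y\<close> only \<open>r\<close> varies.\<close>

lemma MutInf_channel:
  "MutInf (table2 (r * p) (r * (1 - p)) ((1 - r) * q) ((1 - r) * (1 - q))) =
    (entropy2 (r * p + (1 - r) * q) - r * entropy2 p - (1 - r) * entropy2 q) / ln 2"
proof -
  have margins: "r * p + r * (1 - p) = r" "(1 - r) * q + (1 - r) * (1 - q) = 1 - r"
    "r * (1 - p) + (1 - r) * (1 - q) = 1 - (r * p + (1 - r) * q)"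
    by (simp_all add: algebra_simps)
  show ?thesis
    unfolding MutInf_eq_xlnx table2_nth margins entropy2_def xlnx_mult
    by (simp add: algebra_simps)
qed

section \<open>Symmetries and channel form of the margin transformation\<close>

lemma Psi_eq_table2:
  "Psi (x, y, z) = (1 / (exp (x + y + z) + exp x + exp y + exp z)) *\<^sub>R
    table2 (exp (x + y + z)) (exp y) (exp z) (exp x)"
  by (simp add: Psi_def table2_def)

lemma sMutInf_Psi_swap: "sMutInf (Psi (x, z, y)) = sMutInf (Psi (x, y, z))"
proof -
  have "exp (x + z + y) + exp x + exp z + exp y = exp (x + y + z) + exp x + exp y + exp z"
    "exp (x + z + y) = exp (x + y + z)"
    by (simp_all add: add_ac)
  then show ?thesis
    unfolding Psi_eq_table2 scaleR_table2 by (simp only: sMutInf_table2_transpose)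
qed

text \<open>The unnormalised entries at \<open>(- x, y, - z)\<close> are those at
  \<open>(x, y, z)\<close> with the columns exchanged, times the common factor \<open>K\<close>,
  which the normalisation cancels.\<close>

lemma sMutInf_Psi_reflect: "sMutInf (Psi (- x, y, - z)) = - sMutInf (Psi (x, y, z))"
proof -
  define K D where "K = exp (- (x + z))" and "D = exp (x + y + z) + exp x + exp y + exp z"
  have e: "exp (- x + y + - z) = K * exp y" "exp y = K * exp (x + y + z)"
    "exp (- z) = K * exp x" "exp (- x) = K * exp z"
    by (simp_all add: K_def flip: exp_add)
  have D: "exp (- x + y + - z) + exp (- x) + exp y + exp (- z) = K * D"
    using e by (simp add: D_def algebra_simps)
  have cancel: "1 / (K * D) * w = 1 / D * v" if "w = K * v" for v w
    using that by (simp add: K_def)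
  have "Psi (- x, y, - z) = (1 / D) *\<^sub>R table2 (exp y) (exp (x + y + z)) (exp x) (exp z)"
    unfolding Psi_eq_table2 scaleR_table2 D cancel[OF e(1)] cancel[OF e(2)] cancel[OF e(3)]
      cancel[OF e(4)] ..
  moreover have "Psi (x, y, z) = (1 / D) *\<^sub>R table2 (exp (x + y + z)) (exp y) (exp z) (exp x)"
    by (simp add: Psi_eq_table2 D_def)
  ultimately show ?thesis
    unfolding scaleR_table2 by (simp only: sMutInf_table2_swap_columns[of _ _ "1 / D * exp z"])
qed

lemma logistic_add_margin_shift:
  "logistic (y + margin_shift x z) =
    (exp (x + y + z) + exp y) / (exp (x + y + z) + exp x + exp y + exp z)"
proof -
  have "exp (margin_shift x z) = (1 + exp (x + z)) / (exp x + exp z)"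
    by (simp add: margin_shift_def exp_diff)
  then have "exp (y + margin_shift x z) = (exp (x + y + z) + exp y) / (exp x + exp z)"
    by (simp add: exp_add algebra_simps)
  moreover have "n / s / (1 + n / s) = n / (n + s)" if "0 < s" "0 < n" for n s :: real
    using that by (simp add: field_simps)
  ultimately show ?thesis
    by (simp add: logistic_def add.assoc add.left_commute add.commute)
qed

text \<open>In X, Y, Z, the exponentials of the coordinates, all claims are rational identities. The
  margin of column 0 is the row margin \<open>r\<close> with \<open>y\<close> and \<open>z\<close>
  exchanged, because that exchange transposes the table.\<close>

lemma
  defines "r \<equiv> \<lambda>x y z. logistic (y + margin_shift x z)"
    and "p \<equiv> \<lambda>x z. logistic (z + x)" and "q \<equiv> \<lambda>x z. logistic (z - x)"
  shows Psi_eq_channel: "Psi (x, y, z) = table2 (r x y z * p x z) (r x y z * (1 - p x z))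
      ((1 - r x y z) * q x z) ((1 - r x y z) * (1 - q x z))"
    and column_margin_channel: "r x y z * p x z + (1 - r x y z) * q x z = r x z y"
proof -
  define X Y Z where "X = exp x" and "Y = exp y" and "Z = exp z"
  note XYZ = X_def Y_def Z_def
  have pos: "0 < X" "0 < Y" "0 < Z" by (simp_all add: XYZ)
  have nz: "1 + X * Z \<noteq> 0" "X + Z \<noteq> 0" "X * Y * Z + X + Y + Z \<noteq> 0"
    using pos by (smt (verit) mult_pos_pos)+
  have p: "p x z = X * Z / (1 + X * Z)"
    by (simp add: p_def logistic_def XYZ exp_add mult.commute)
  have q: "q x z = Z / (X + Z)"
    by (simp add: q_def logistic_def XYZ exp_diff field_simps)
  have r: "r x y z = Y * (1 + X * Z) / (X * Y * Z + X + Y + Z)"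
    "r x z y = Z * (1 + X * Y) / (X * Y * Z + X + Y + Z)"
    by (simp_all add: r_def logistic_add_margin_shift XYZ exp_add algebra_simps)
  have "1 - r x y z = (X + Z) / (X * Y * Z + X + Y + Z)" "1 - p x z = 1 / (1 + X * Z)"
    "1 - q x z = X / (X + Z)"
    using nz by (simp_all add: p q r field_simps)
  note one_minus = this
  have cells: "r x y z * p x z = X * Y * Z / (X * Y * Z + X + Y + Z)"
    "r x y z * (1 - p x z) = Y / (X * Y * Z + X + Y + Z)"
    "(1 - r x y z) * q x z = Z / (X * Y * Z + X + Y + Z)"
    "(1 - r x y z) * (1 - q x z) = X / (X * Y * Z + X + Y + Z)"
    using nz unfolding one_minus unfolding p q r by (simp_all add: mult_ac)
  have "exp (x + y + z) = X * Y * Z"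
    by (simp add: XYZ exp_add)
  then show "Psi (x, y, z) = table2 (r x y z * p x z) (r x y z * (1 - p x z))
      ((1 - r x y z) * q x z) ((1 - r x y z) * (1 - q x z))"
    unfolding Psi_eq_table2 scaleR_table2 cells by (simp flip: XYZ)
  show "r x y z * p x z + (1 - r x y z) * q x z = r x z y"
    unfolding cells r(2) by (simp add: algebra_simps flip: add_divide_distrib)
qed

lemma sMutInf_at_channel:
  assumes "0 < x"
  shows "sMutInf_at x (y, z) =
    (entropy2 (logistic (y + margin_shift x z) * logistic (z + x)
        + (1 - logistic (y + margin_shift x z)) * logistic (z - x))
     - logistic (y + margin_shift x z) * entropy2 (logistic (z + x))
     - (1 - logistic (y + margin_shift x z)) * entropy2 (logistic (z - x))) / ln 2"
proof -
  define k where "k = 1 / (exp (x + y + z) + exp x + exp y + exp z)"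
  have "0 < k"
    by (simp add: k_def add_pos_pos)
  \<comment> \<open>The two products are exp(2x + y + z) and exp(y + z), so the sign of the
    determinant is that of \<open>x\<close>.\<close>
  moreover have "0 < exp (x + y + z) * exp x - exp y * exp z"
    using assms by (simp flip: exp_add)
  ultimately have "0 < k * k * (exp (x + y + z) * exp x - exp y * exp z)"
    by simp
  also have "\<dots> = Psi (x, y, z) $ 0 $ 0 * Psi (x, y, z) $ 1 $ 1
      - Psi (x, y, z) $ 0 $ 1 * Psi (x, y, z) $ 1 $ 0"
    unfolding Psi_eq_table2 scaleR_table2 k_def[symmetric] table2_nth
    by (simp only: algebra_simps)
  finally have "sgn (Psi (x, y, z) $ 0 $ 0 * Psi (x, y, z) $ 1 $ 1
      - Psi (x, y, z) $ 0 $ 1 * Psi (x, y, z) $ 1 $ 0) = 1"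
    by simp
  then show ?thesis
    unfolding sMutInf_at_def sMutInf_def by (simp add: Psi_eq_channel MutInf_channel)
qed

lemma DERIV_sMutInf_at:
  assumes "0 < x"
  shows "((\<lambda>y. sMutInf_at x (y, z)) has_real_derivative
    (entropy_gap x z - channel_width x z * (z + margin_shift x y)) *
    (logistic (y + margin_shift x z) * (1 - logistic (y + margin_shift x z)) / ln 2)) (at y)"
proof -
  define r p q where "r = (\<lambda>y. logistic (y + margin_shift x z))" and "p = logistic (z + x)"
    and "q = logistic (z - x)"
  have c: "r y * p + (1 - r y) * q = logistic (z + margin_shift x y)"
    unfolding r_def p_def q_def by (rule column_margin_channel)
  have r: "(r has_real_derivative r y * (1 - r y)) (at y)"
    unfolding r_def by (auto intro!: derivative_eq_intros)
  have "((\<lambda>y. r y * p + (1 - r y) * q) has_real_derivative (p - q) * (r y * (1 - r y))) (at y)"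
    by (auto intro!: derivative_eq_intros r simp: algebra_simps)
  \<comment> \<open>By \<open>c\<close> the output probability has log-odds
    \<open>z + margin_shift x y\<close>, and the derivative of the entropy is minus the
    log-odds.\<close>
  then have h: "((\<lambda>y. entropy2 (r y * p + (1 - r y) * q)) has_real_derivative
      - (z + margin_shift x y) * ((p - q) * (r y * (1 - r y)))) (at y)"
    by (rule DERIV_entropy2[THEN DERIV_cong])
      (simp_all only: c logistic_pos logistic_less_1 ln_one_minus_logistic, simp)
  \<comment> \<open>\<open>A\<close> and \<open>B\<close> stand for the two conditional entropies,
    which are constant in y.\<close>
  have "((\<lambda>y. (entropy2 (r y * p + (1 - r y) * q) - r y * A - (1 - r y) * B) / ln 2)
    has_real_derivative
      (B - A - (p - q) * (z + margin_shift x y)) * (r y * (1 - r y) / ln 2)) (at y)" for A B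
    by (rule DERIV_cong, (rule DERIV_cdivide DERIV_diff DERIV_cmult_right DERIV_const h r)+)
      (simp add: field_simps)
  then show ?thesis
    using assms by (simp add: sMutInf_at_channel r_def p_def q_def entropy_gap_def channel_width_def)
qed

section \<open>Local extrema and critical points\<close>

lemma local_extremum_at_imp_DERIV_eq_0:
  assumes ext: "local_extremum_at f (a, b)"
    and deriv: "((\<lambda>y. f (y, b)) has_real_derivative D) (at a)"
  shows "D = 0"
proof -
  have lim: "filterlim (\<lambda>y. (y, b)) (nhds (a, b)) (nhds a)"
    by (intro tendsto_Pair tendsto_const filterlim_ident)
  from ext consider "\<forall>\<^sub>F y in nhds a. f (y, b) \<le> f (a, b)" | "\<forall>\<^sub>F y in nhds a. f (a, b) \<le> f (y, b)"
    unfolding local_extremum_at_def local_max_at_def local_min_at_def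
    using eventually_compose_filterlim[OF _ lim] by blast
  then show ?thesis
  proof cases
    case 1
    then obtain d where "0 < d" "\<forall>y. dist y a < d \<longrightarrow> f (y, b) \<le> f (a, b)"
      by (auto simp: eventually_nhds_metric)
    then show ?thesis
      by (intro DERIV_local_max[OF deriv]) (auto simp: dist_real_def abs_minus_commute)
  next
    case 2
    then obtain d where "0 < d" "\<forall>y. dist y a < d \<longrightarrow> f (a, b) \<le> f (y, b)"
      by (auto simp: eventually_nhds_metric)
    then show ?thesis
      by (intro DERIV_local_min[OF deriv]) (auto simp: dist_real_def abs_minus_commute)
  qed
qed

lemma local_extremum_at_imp_balanced:
  assumes "0 < x" "local_extremum_at (sMutInf_at x) (y, z)"
  shows "balanced x y z"
proof -
  have "logistic (y + margin_shift x z) * (1 - logistic (y + margin_shift x z)) \<noteq> 0"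
    using logistic_pos logistic_less_1 by (simp add: less_imp_neq[symmetric])
  then show ?thesis
    using local_extremum_at_imp_DERIV_eq_0[OF assms(2) DERIV_sMutInf_at[OF assms(1)]]
    by (simp add: balanced_def)
qed

lemma local_extremum_at_comp:
  assumes ext: "local_extremum_at f p" and g: "isCont g q" "g q = p"
  shows "local_extremum_at (f \<circ> g) q"
proof -
  have "filterlim g (nhds p) (nhds q)"
    using g(1) by (simp add: isCont_def tendsto_at_iff_tendsto_nhds flip: g(2))
  then show ?thesis
    using ext g(2) eventually_compose_filterlim
    unfolding local_extremum_at_def local_max_at_def local_min_at_def by fastforce
qed

lemma local_extremum_at_minus:
  "local_extremum_at (\<lambda>q. - f q) p \<longleftrightarrow> local_extremum_at f p"
  by (auto simp: local_extremum_at_def local_max_at_def local_min_at_def)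

text \<open>Invariance under exchanging \<open>y\<close> and \<open>z\<close> turns the equation for
  the \<open>y\<close>-derivative into the one for the \<open>z\<close>-derivative, so no second
  derivative computation is required.\<close>

lemma local_extremum_at_sMutInf_at_imp:
  assumes x: "0 < x" and ext: "local_extremum_at (sMutInf_at x) p"
  shows "p = (0, 0)"
proof -
  obtain y z where p: "p = (y, z)" by fastforce
  have "sMutInf_at x \<circ> prod.swap = sMutInf_at x"
    by (auto simp: fun_eq_iff sMutInf_at_def sMutInf_Psi_swap)
  moreover have "local_extremum_at (sMutInf_at x \<circ> prod.swap) (z, y)"
    using ext p by (intro local_extremum_at_comp) (auto simp: prod.swap_def intro!: continuous_intros)
  ultimately have "balanced x z y"
    using local_extremum_at_imp_balanced[OF x] by simp
  moreover have "balanced x y z"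
    using local_extremum_at_imp_balanced[OF x] ext p by simp
  ultimately show ?thesis
    using balanced_both_imp_eq_0[OF x] p by blast
qed

text \<open>At the origin both margins are uniform, so the output entropy is \<open>ln 2\<close>,
  while both conditional entropies equal \<open>entropy2 (logistic x)\<close>, which is
  smaller.\<close>

lemma sMutInf_at_origin_pos:
  assumes "0 < x"
  shows "0 < sMutInf_at x (0, 0)"
proof -
  have "margin_shift x 0 = 0"
    by (simp add: margin_shift_def add.commute)
  moreover have "logistic x \<noteq> 1 / 2"
    using logistic_less_iff[of 0 x] assms by (simp add: logistic_0)
  then have "entropy2 (logistic x) < ln 2"
    by (intro entropy2_less_ln_2 logistic_pos logistic_less_1)
  moreover have "entropy2 (1 / 2) = ln 2"
    by (simp add: entropy2_def xlnx_def ln_div)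
  ultimately show ?thesis
    using assms by (simp add: sMutInf_at_channel logistic_0 logistic_minus entropy2_flip field_simps)
qed

subsection \<open>Continuity up to the boundary\<close>

definition closed_tables :: "(real ^ 2 ^ 2) set" where
  "closed_tables = {t. (\<forall>i j. 0 \<le> t $ i $ j) \<and> (\<Sum>i\<in>UNIV. \<Sum>j\<in>UNIV. t $ i $ j) = 1}"

lemma closure_tables_subset: "closure tables \<subseteq> closed_tables"
proof (rule closure_minimal)
  show "tables \<subseteq> closed_tables"
    by (auto simp: tables_def closed_tables_def less_imp_le)
  show "closed closed_tables"
    unfolding closed_tables_def
    by (intro closed_Collect_conj closed_Collect_all closed_Collect_le closed_Collect_eq
        continuous_intros)
qed

text \<open>With total mass 1, a vanishing determinant makes every entry the product of its two
  margins; \<open>xlnx_mult\<close> then splits the entry terms into exactly the margin terms. This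
  includes boundary tables.\<close>

lemma MutInf_eq_0_if_det_eq_0:
  assumes "t \<in> closed_tables" "t $ 0 $ 0 * t $ 1 $ 1 - t $ 0 $ 1 * t $ 1 $ 0 = 0"
  shows "MutInf t = 0"
proof -
  define a b c d where abcd: "a = t $ 0 $ 0" "b = t $ 0 $ 1" "c = t $ 1 $ 0" "d = t $ 1 $ 1"
  have sum: "a + b + c + d = 1" and det: "a * d = b * c"
    using assms by (simp_all add: abcd closed_tables_def sum_UNIV_2)
  have d: "d = 1 - a - b - c"
    using sum by simp
  have cells: "a = (a + b) * (a + c)" "b = (a + b) * (b + d)" "c = (c + d) * (a + c)"
    "d = (c + d) * (b + d)"
    using det unfolding d by algebra+
  have x: "xlnx a = (a + c) * xlnx (a + b) + (a + b) * xlnx (a + c)"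
    "xlnx b = (b + d) * xlnx (a + b) + (a + b) * xlnx (b + d)"
    "xlnx c = (a + c) * xlnx (c + d) + (c + d) * xlnx (a + c)"
    "xlnx d = (b + d) * xlnx (c + d) + (c + d) * xlnx (b + d)"
    by (subst cells, rule xlnx_mult)+
  have "xlnx a + xlnx b + xlnx c + xlnx d =
    (a + b + c + d) * (xlnx (a + b) + xlnx (c + d) + xlnx (a + c) + xlnx (b + d))"
    unfolding x by (simp only: algebra_simps)
  then show ?thesis
    unfolding MutInf_eq_xlnx abcd[symmetric] sum by simp
qed

text \<open>The jump of the sign is harmless: at a zero of \<open>f\<close> the product is bounded
  by the absolute value of \<open>g\<close>, which tends to 0 there.\<close>

lemma continuous_on_sgn_mult:
  fixes f g :: "'a::topological_space \<Rightarrow> real"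
  assumes f: "continuous_on S f" and g: "continuous_on S g"
    and zero: "\<And>s. s \<in> S \<Longrightarrow> f s = 0 \<Longrightarrow> g s = 0"
  shows "continuous_on S (\<lambda>s. sgn (f s) * g s)"
  unfolding continuous_on_def
proof
  fix s assume s: "s \<in> S"
  show "((\<lambda>s. sgn (f s) * g s) \<longlongrightarrow> sgn (f s) * g s) (at s within S)"
  proof (cases "f s = 0")
    case True
    have "(g \<longlongrightarrow> 0) (at s within S)"
      using g s zero[OF s True] by (auto simp: continuous_on_def)
    then have "((\<lambda>s. sgn (f s) * g s) \<longlongrightarrow> 0) (at s within S)"
      by (rule Lim_null_comparison[OF always_eventually, rotated, OF tendsto_norm_zero])
        (simp add: abs_mult abs_sgn_eq)
    then show ?thesis
      using True by simp
  next
    case False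
    then show ?thesis
      using f g s by (auto simp: continuous_on_def intro!: tendsto_mult tendsto_sgn)
  qed
qed

lemma continuous_on_sMutInf: "continuous_on closed_tables sMutInf"
  unfolding sMutInf_def
proof (rule continuous_on_sgn_mult)
  show "continuous_on closed_tables MutInf"
    unfolding MutInf_eq_xlnx by (intro continuous_intros) auto
qed (auto intro!: continuous_intros MutInf_eq_0_if_det_eq_0)

lemma continuous_on_table2 [continuous_intros]:
  assumes "continuous_on S a" "continuous_on S b" "continuous_on S c" "continuous_on S d"
  shows "continuous_on S (\<lambda>s. table2 (a s) (b s) (c s) (d s))"
  unfolding table2_def
proof (intro continuous_on_vec_lambda)
  fix i j :: 2
  show "continuous_on S (\<lambda>s. if i = 0 then if j = 0 then a s else b s else if j = 0 then c s else d s)"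
    using assms by (cases "i = 0"; cases "j = 0"; simp)
qed

text \<open>The substitution \<open>a = logistic x\<close>, \<open>b = logistic y\<close>, \<open>c = logistic z\<close> identifies the
  compactified cube with the unit cube and makes \<^const>\<open>Psi\<close> rational; the denominator
  vanishes exactly at the four vertices of \<^const>\<open>V_b\<close>.\<close>

definition cube_weight :: "real \<times> real \<times> real \<Rightarrow> real" where
  "cube_weight = (\<lambda>(a, b, c).
    a * b * c + (1 - a) * b * (1 - c) + (1 - a) * (1 - b) * c + a * (1 - b) * (1 - c))"

definition cube_table :: "real \<times> real \<times> real \<Rightarrow> real ^ 2 ^ 2" where
  "cube_table = (\<lambda>(a, b, c). (1 / cube_weight (a, b, c)) *\<^sub>R
    table2 (a * b * c) ((1 - a) * b * (1 - c)) ((1 - a) * (1 - b) * c) (a * (1 - b) * (1 - c)))"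

definition cube_domain :: "(real \<times> real \<times> real) set" where
  "cube_domain = {s \<in> {0..1} \<times> {0..1} \<times> {0..1}. cube_weight s \<noteq> 0}"

lemma cube_weight_eq_0_iff:
  assumes "a \<in> {0..1}" "b \<in> {0..1}" "c \<in> {0..1}"
  shows "cube_weight (a, b, c) = 0 \<longleftrightarrow>
    a * b * c = 0 \<and> (1 - a) * b * (1 - c) = 0 \<and> (1 - a) * (1 - b) * c = 0 \<and> a * (1 - b) * (1 - c) = 0"
proof -
  have "0 \<le> a * b * c" "0 \<le> (1 - a) * b * (1 - c)" "0 \<le> (1 - a) * (1 - b) * c"
    "0 \<le> a * (1 - b) * (1 - c)"
    using assms by simp_all
  then show ?thesis
    unfolding cube_weight_def prod.case by linarith
qed

text \<open>The four excluded points are the vertices of \<open>V_b\<close> with 0 for minus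
  infinity and 1 for plus infinity.\<close>

lemma cube_domain_iff:
  "(a, b, c) \<in> cube_domain \<longleftrightarrow> a \<in> {0..1} \<and> b \<in> {0..1} \<and> c \<in> {0..1} \<and>
    (a, b, c) \<notin> {(0, 0, 0), (0, 1, 1), (1, 0, 1), (1, 1, 0)}"
proof (cases "a \<in> {0..1} \<and> b \<in> {0..1} \<and> c \<in> {0..1}")
  case True
  then have "cube_weight (a, b, c) = 0 \<longleftrightarrow> (a, b, c) \<in> {(0, 0, 0), (0, 1, 1), (1, 0, 1), (1, 1, 0)}"
    by (simp add: cube_weight_eq_0_iff) (metis zero_neq_one)
  with True show ?thesis
    by (simp add: cube_domain_def)
next
  case False
  then show ?thesis
    by (simp add: cube_domain_def) blast
qed

lemma continuous_on_sMutInf_cube_table: "continuous_on cube_domain (sMutInf \<circ> cube_table)"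
proof (rule continuous_on_compose)
  have "continuous_on cube_domain (\<lambda>s. case s of (a, b, c) \<Rightarrow> cube_weight (a, b, c))"
    unfolding cube_weight_def prod.case by (simp add: split_beta) (intro continuous_intros)
  then show "continuous_on cube_domain cube_table"
    unfolding cube_table_def split_beta
    by (intro continuous_intros) (auto simp: cube_domain_def)
  have "cube_table ` cube_domain \<subseteq> closed_tables"
  proof clarify
    fix a b c assume s: "(a, b, c) \<in> cube_domain"
    have nn: "0 \<le> a * b * c" "0 \<le> (1 - a) * b * (1 - c)" "0 \<le> (1 - a) * (1 - b) * c"
      "0 \<le> a * (1 - b) * (1 - c)"
      using s by (auto simp: cube_domain_def)
    have "cube_weight (a, b, c) \<noteq> 0" "0 \<le> cube_weight (a, b, c)"
      using s nn by (auto simp: cube_domain_def cube_weight_def)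
    then show "cube_table (a, b, c) \<in> closed_tables"
      using nn unfolding cube_table_def prod.case scaleR_table2
      by (simp add: closed_tables_def all_2_iff sum_UNIV_2 flip: add_divide_distrib)
        (simp add: cube_weight_def add.assoc)
  qed
  then show "continuous_on (cube_table ` cube_domain) sMutInf"
    by (rule continuous_on_subset[OF continuous_on_sMutInf])
qed

lemma cube_table_logistic:
  "cube_table (logistic x, logistic y, logistic z) = Psi (x, y, z)"
proof -
  define X Y Z where "X = exp x" and "Y = exp y" and "Z = exp z"
  note XYZ = X_def Y_def Z_def
  have pos: "0 < X" "0 < Y" "0 < Z" by (simp_all add: XYZ)
  then have nz: "1 + X \<noteq> 0" "1 + Y \<noteq> 0" "1 + Z \<noteq> 0" "X * Y * Z + X + Y + Z \<noteq> 0"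
    by (smt (verit) mult_pos_pos)+
  \<comment> \<open>All four numerators of \<open>cube_table\<close> share this denominator, so it
    drops out on normalising.\<close>
  define E where "E = (1 + X) * (1 + Y) * (1 + Z)"
  have E: "E \<noteq> 0" using nz by (simp add: E_def)
  have l: "logistic x = X / (1 + X)" "logistic y = Y / (1 + Y)" "logistic z = Z / (1 + Z)"
    "1 - logistic x = 1 / (1 + X)" "1 - logistic y = 1 / (1 + Y)" "1 - logistic z = 1 / (1 + Z)"
    using nz by (simp_all add: logistic_def XYZ field_simps)
  have w: "logistic x * logistic y * logistic z = X * Y * Z / E"
    "(1 - logistic x) * logistic y * (1 - logistic z) = Y / E"
    "(1 - logistic x) * (1 - logistic y) * logistic z = Z / E"
    "logistic x * (1 - logistic y) * (1 - logistic z) = X / E"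
    unfolding l(4-6) unfolding l(1-3) by (simp_all add: E_def)
  have "cube_weight (logistic x, logistic y, logistic z) = (X * Y * Z + X + Y + Z) / E"
    unfolding cube_weight_def prod.case w by (simp add: algebra_simps flip: add_divide_distrib)
  moreover have "exp (x + y + z) = X * Y * Z"
    by (simp add: XYZ exp_add)
  ultimately show ?thesis
    unfolding cube_table_def prod.case w Psi_eq_table2 scaleR_table2
    using E by (simp flip: XYZ)
qed

lemma sMutInf_at_eq_cube_table:
  "sMutInf_at x (y, z) = (sMutInf \<circ> cube_table) (logistic x, logistic y, logistic z)"
  by (simp add: sMutInf_at_def cube_table_logistic)

lemma logistic_in_cube_domain:
  assumes "a \<in> {0..1}"
  shows "(a, logistic y, logistic z) \<in> cube_domain"
  using assms logistic_pos[of y] logistic_less_1[of y] logistic_pos[of z] logistic_less_1[of z]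
  by (auto simp: cube_domain_iff)

lemma continuous_on_sMutInf_at: "continuous_on UNIV (sMutInf_at x)"
proof -
  have "continuous_on UNIV
      ((sMutInf \<circ> cube_table) \<circ> (\<lambda>p. (logistic x, logistic (fst p), logistic (snd p))))"
  proof (rule continuous_on_compose[OF _ continuous_on_subset[OF continuous_on_sMutInf_cube_table]])
    show "range (\<lambda>p. (logistic x, logistic (fst p), logistic (snd p))) \<subseteq> cube_domain"
      using logistic_pos[of x] logistic_less_1[of x] by (auto intro!: logistic_in_cube_domain)
  qed (intro continuous_intros)
  then show ?thesis
    by (simp add: comp_def sMutInf_at_eq_cube_table[unfolded comp_def, symmetric])
qed

text \<open>Outside a compact subset of the open square the function is small, and the logistic
  coordinates pull that compact set back to a bounded one.\<close>

lemma tendsto_logistic_pair_at_infinity: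
  fixes h :: "real \<times> real \<Rightarrow> real"
  assumes cont: "continuous_on ({0..1} \<times> {0..1}) h"
    and boundary: "\<And>b c. b \<in> {0, 1} \<or> c \<in> {0, 1} \<Longrightarrow> h (b, c) = 0"
  shows "((\<lambda>(y, z). h (logistic y, logistic z)) \<longlongrightarrow> 0) at_infinity"
proof (rule tendstoI)
  fix e :: real assume "0 < e"
  define K where "K = {p \<in> {0..1} \<times> {0..1}. e \<le> \<bar>h p\<bar>}"
  have "compact K"
  proof -
    have "closed K"
      unfolding K_def
      by (intro continuous_closed_preimage_constant continuous_on_closed_Collect_le
          continuous_intros cont closed_Times)
    moreover have "bounded K"
      by (rule bounded_subset[of "{0..1} \<times> {0..1}"]) (auto simp: K_def intro!: bounded_Times)
    ultimately show ?thesis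
      by (simp add: compact_eq_bounded_closed)
  qed
  define logit where "logit = (\<lambda>t::real. ln t - ln (1 - t))"
  have "K \<subseteq> {0<..<1} \<times> {0<..<1}"
  proof clarify
    fix b c assume "(b, c) \<in> K"
    then have "0 \<le> b" "b \<le> 1" "0 \<le> c" "c \<le> 1" "h (b, c) \<noteq> 0"
      using \<open>0 < e\<close> by (auto simp: K_def)
    then show "b \<in> {0<..<1} \<and> c \<in> {0<..<1}"
      using boundary[of b c] by force
  qed
  then have "continuous_on K (\<lambda>p. (logit (fst p), logit (snd p)))"
    unfolding logit_def by (intro continuous_intros) auto
  then have "compact ((\<lambda>p. (logit (fst p), logit (snd p))) ` K)"
    using \<open>compact K\<close> by (rule compact_continuous_image)
  then have "bounded ((\<lambda>p. (logit (fst p), logit (snd p))) ` K)"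
    by (rule compact_imp_bounded)
  then obtain B where B: "\<And>p. p \<in> K \<Longrightarrow> norm (logit (fst p), logit (snd p)) \<le> B"
    unfolding bounded_iff by blast
  have logit: "logit (logistic t) = t" for t
    by (simp add: logit_def ln_one_minus_logistic)
  have small: "\<bar>h (logistic y, logistic z)\<bar> < e" if "B + 1 \<le> norm (y, z)" for y z
  proof (rule ccontr)
    assume "\<not> ?thesis"
    then have "(logistic y, logistic z) \<in> K"
      using logistic_pos logistic_less_1 by (auto simp: K_def less_imp_le)
    from B[OF this] that show False
      by (simp add: logit)
  qed
  show "\<forall>\<^sub>F p in at_infinity. dist (case p of (y, z) \<Rightarrow> h (logistic y, logistic z)) 0 < e"
    unfolding eventually_at_infinity
    by (rule exI[of _ "B + 1"]) (use small in auto)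
qed

lemma sMutInf_at_tendsto_0: "(sMutInf_at x \<longlongrightarrow> 0) at_infinity"
proof -
  define h where "h = (\<lambda>p. (sMutInf \<circ> cube_table) (logistic x, p))"
  have "continuous_on ({0..1} \<times> {0..1}) ((sMutInf \<circ> cube_table) \<circ> Pair (logistic x))"
  proof (rule continuous_on_compose[OF _ continuous_on_subset[OF continuous_on_sMutInf_cube_table]])
    \<comment> \<open>The excluded vertices have first coordinate 0 or 1, so a slice at
      \<open>logistic x\<close> contains the whole closed square.\<close>
    show "Pair (logistic x) ` ({0..1} \<times> {0..1}) \<subseteq> cube_domain"
      using logistic_pos[of x] logistic_less_1[of x] by (auto simp: cube_domain_iff)
  qed (intro continuous_intros)
  then have "continuous_on ({0..1} \<times> {0..1}) h"
    by (simp add: h_def comp_def)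
  \<comment> \<open>On these lines a whole row or column of the table vanishes, hence so does the
    determinant and its sign.\<close>
  moreover have "h (b, c) = 0" if "b \<in> {0, 1} \<or> c \<in> {0, 1}" for b c
    using that unfolding h_def comp_def cube_table_def prod.case scaleR_table2
    by (auto simp: sMutInf_def)
  ultimately have "((\<lambda>(y, z). h (logistic y, logistic z)) \<longlongrightarrow> 0) at_infinity"
    by (rule tendsto_logistic_pair_at_infinity)
  moreover have "(\<lambda>(y, z). h (logistic y, logistic z)) = sMutInf_at x"
    by (auto simp: h_def sMutInf_at_eq_cube_table)
  ultimately show ?thesis by simp
qed

section \<open>The global extremum at the origin\<close>

lemma sMutInf_at_le_origin:
  assumes "0 < x"
  shows "sMutInf_at x p \<le> sMutInf_at x (0, 0)"
proof -
  let ?f = "sMutInf_at x"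
  have pos: "0 < ?f (0, 0)"
    by (rule sMutInf_at_origin_pos[OF assms])
  then have "\<forall>\<^sub>F p in at_infinity. ?f p < ?f (0, 0)"
    by (rule order_tendstoD(2)[OF sMutInf_at_tendsto_0])
  then obtain B where B: "\<And>p. B \<le> norm p \<Longrightarrow> ?f p < ?f (0, 0)"
    by (auto simp: eventually_at_infinity)
  \<comment> \<open>The absolute value keeps the radius nonnegative, so that the ball contains the
    origin, which dominates all values outside.\<close>
  have "compact (cball (0::real \<times> real) \<bar>B\<bar>)" "cball (0::real \<times> real) \<bar>B\<bar> \<noteq> {}"
    by auto
  then obtain m where m: "m \<in> cball 0 \<bar>B\<bar>" "\<And>p. p \<in> cball 0 \<bar>B\<bar> \<Longrightarrow> ?f p \<le> ?f m"
    using continuous_attains_sup continuous_on_subset[OF continuous_on_sMutInf_at] by (metis subset_UNIV)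
  have max: "?f p \<le> ?f m" for p
  proof (cases "p \<in> cball 0 \<bar>B\<bar>")
    case False
    then have "?f p < ?f (0, 0)"
      by (intro B) auto
    also have "\<dots> \<le> ?f m"
      by (intro m) (auto simp flip: zero_prod_def)
    finally show ?thesis by simp
  qed (rule m)
  have "local_extremum_at ?f m"
    unfolding local_extremum_at_def local_max_at_def
    by (intro disjI1 always_eventually allI max)
  then have "m = (0, 0)"
    by (rule local_extremum_at_sMutInf_at_imp[OF assms])
  then show ?thesis
    using max by simp
qed

lemma sMutInf_at_minus: "sMutInf_at (- x) = (\<lambda>q. - sMutInf_at x q) \<circ> apsnd uminus"
proof (rule ext, clarify)
  fix y z
  show "sMutInf_at (- x) (y, z) = ((\<lambda>q. - sMutInf_at x q) \<circ> apsnd uminus) (y, z)"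
    using sMutInf_Psi_reflect[of x y "- z"] by (simp add: sMutInf_at_def)
qed

lemma sMutInf_at_ge_origin:
  assumes "x < 0"
  shows "sMutInf_at x (0, 0) \<le> sMutInf_at x p"
  using sMutInf_at_le_origin[of "- x" "apsnd uminus p"] assms
  by (cases p) (simp add: sMutInf_at_minus)

lemma local_extremum_at_sMutInf_at_iff:
  assumes "x \<noteq> 0"
  shows "local_extremum_at (sMutInf_at x) p \<longleftrightarrow> p = (0, 0)"
proof
  assume "p = (0, 0)"
  then show "local_extremum_at (sMutInf_at x) p"
    using sMutInf_at_le_origin[of x] sMutInf_at_ge_origin[of x] assms
    by (cases "0 < x") (auto simp: local_extremum_at_def local_max_at_def local_min_at_def)
next
  assume ext: "local_extremum_at (sMutInf_at x) p"
  show "p = (0, 0)"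
  proof (cases "0 < x")
    case True
    then show ?thesis
      using local_extremum_at_sMutInf_at_imp ext by blast
  next
    case False
    let ?r = "apsnd uminus :: real \<times> real \<Rightarrow> real \<times> real"
    have "isCont ?r q" for q
      unfolding apsnd_def map_prod_def split_beta id_def by (intro continuous_intros)
    \<comment> \<open>Reflecting \<open>z\<close> and negating transports the extremum to the
      parameter \<open>- x\<close>, which is positive.\<close>
    then have "local_extremum_at (sMutInf_at x \<circ> ?r) (?r p)"
      using ext by (intro local_extremum_at_comp) (auto simp: prod_eq_iff)
    then have "local_extremum_at (\<lambda>q. - (sMutInf_at x \<circ> ?r) q) (?r p)"
      by (subst local_extremum_at_minus)
    then have "local_extremum_at (sMutInf_at (- x)) (?r p)"
      by (simp add: sMutInf_at_minus comp_def)
    then have "?r p = (0, 0)"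
      using False assms by (intro local_extremum_at_sMutInf_at_imp) auto
    then show ?thesis
      by (auto simp: prod_eq_iff)
  qed
qed

section \<open>Limits for x tending to plus or minus infinity\<close>

lemma entropy2_logistic: "entropy2 (logistic t) = ln (1 + exp t) - t * logistic t"
proof -
  have "ln (logistic t) = t - ln (1 + exp t)"
    by (simp add: logistic_def ln_div)
  then show ?thesis
    by (simp add: entropy2_def xlnx_def ln_one_minus_logistic algebra_simps)
qed

lemma cube_table_1_logistic:
  "cube_table (1, logistic y, logistic z) = table2 (logistic (y + z)) 0 0 (1 - logistic (y + z))"
proof -
  define E where "E = (1 + exp y) * (1 + exp z)"
  have E: "E \<noteq> 0" by (simp add: E_def)
  have w: "logistic y * logistic z = exp (y + z) / E"
    by (simp add: logistic_def E_def exp_add)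
  have w': "(1 - logistic y) * (1 - logistic z) = 1 / E"
    by (simp add: logistic_def E_def exp_minus field_simps flip: logistic_minus)
  have "cube_weight (1, logistic y, logistic z) = (1 + exp (y + z)) / E"
    by (simp add: cube_weight_def w w' add_divide_distrib)
  moreover have "1 - logistic (y + z) = 1 / (1 + exp (y + z))"
    by (simp add: logistic_def field_simps)
  ultimately show ?thesis
    using E by (simp add: cube_table_def scaleR_table2 w w') (simp add: logistic_def)
qed

text \<open>The limit is the value of the continuous extension on the face \<open>a = 1\<close>. The
  table there is diagonal, so row and column determine each other and the mutual information is the
  entropy of a margin, with log-odds \<open>y + z\<close>.\<close>

lemma sMutInf_at_tendsto_at_top:
  "((\<lambda>x. sMutInf_at x (y, z)) \<longlongrightarrow>
    log 2 (exp (y + z) + 1) - exp (y + z) / (exp (y + z) + 1) * log 2 (exp (y + z))) at_top"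
proof -
  let ?b = "logistic y" and ?c = "logistic z" and ?s = "logistic (y + z)"
  have "((\<lambda>x. (sMutInf \<circ> cube_table) (logistic x, ?b, ?c)) \<longlongrightarrow>
      (sMutInf \<circ> cube_table) (1, ?b, ?c)) at_top"
  proof (rule continuous_on_tendsto_compose[OF continuous_on_sMutInf_cube_table])
    show "((\<lambda>x. (logistic x, ?b, ?c)) \<longlongrightarrow> (1, ?b, ?c)) at_top"
      by (intro tendsto_intros tendsto_logistic_at_top)
    show "\<forall>\<^sub>F x in at_top. (logistic x, ?b, ?c) \<in> cube_domain"
      by (intro always_eventually allI logistic_in_cube_domain)
        (auto simp: logistic_pos logistic_less_1 less_imp_le)
  qed (auto intro: logistic_in_cube_domain)
  moreover have "(sMutInf \<circ> cube_table) (1, ?b, ?c) = entropy2 ?s / ln 2"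
    using logistic_pos[of "y + z"] logistic_less_1[of "y + z"]
    by (simp add: cube_table_1_logistic sMutInf_def MutInf_eq_xlnx entropy2_def)
  moreover have "entropy2 ?s / ln 2 =
      log 2 (exp (y + z) + 1) - exp (y + z) / (exp (y + z) + 1) * log 2 (exp (y + z))"
    unfolding entropy2_logistic
    by (simp add: logistic_def log_def diff_divide_distrib add.commute)
  ultimately show ?thesis
    by (simp only: sMutInf_at_eq_cube_table)
qed

lemma sMutInf_at_tendsto_at_bot:
  "((\<lambda>x. sMutInf_at x (y, z)) \<longlongrightarrow>
    - (log 2 (exp (y - z) + 1) - exp (y - z) / (exp (y - z) + 1) * log 2 (exp (y - z)))) at_bot"
  using tendsto_minus[OF sMutInf_at_tendsto_at_top[of y "- z"]]
  by (simp add: filterlim_at_bot_mirror sMutInf_at_minus)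

section \<open>Extension to the compactified cube and conclusion\<close>

definition elogistic :: "ereal \<Rightarrow> real" where
  "elogistic x = (case x of ereal r \<Rightarrow> logistic r | PInfty \<Rightarrow> 1 | MInfty \<Rightarrow> 0)"

lemma elogistic_simps [simp]:
  "elogistic (ereal r) = logistic r" "elogistic \<infinity> = 1" "elogistic (-\<infinity>) = 0"
  by (simp_all add: elogistic_def)

lemma elogistic_bounds: "elogistic x \<in> {0..1}"
  by (cases x) (auto simp: logistic_pos logistic_less_1 less_imp_le)

lemma elogistic_eq_iff: "elogistic x = 0 \<longleftrightarrow> x = -\<infinity>" "elogistic x = 1 \<longleftrightarrow> x = \<infinity>"
proof -
  have "logistic r \<noteq> 0" "logistic r \<noteq> 1" for r
    using logistic_pos[of r] logistic_less_1[of r] by simp_all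
  then show "elogistic x = 0 \<longleftrightarrow> x = -\<infinity>" "elogistic x = 1 \<longleftrightarrow> x = \<infinity>"
    by (cases x; simp)+
qed

lemma isCont_elogistic: "isCont elogistic x"
proof (cases x)
  case (real r)
  have "isCont logistic r"
    using continuous_on_logistic[OF continuous_on_id, of UNIV]
    by (simp add: continuous_on_eq_continuous_at)
  then show ?thesis
    unfolding isCont_def unfolding real at_ereal filterlim_filtermap by simp
next
  case PInf
  then show ?thesis
    unfolding isCont_def unfolding PInf at_infty_ereal_eq_at_top filterlim_filtermap
    using tendsto_logistic_at_top by simp
next
  case MInf
  \<comment> \<open>Nothing lies below minus infinity, so the punctured neighbourhoods there are the
    right-sided ones.\<close>
  have "UNIV - {-\<infinity>} = {-\<infinity><..} - {-\<infinity>::ereal}"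
    by auto
  then have "at (-\<infinity>::ereal) = filtermap ereal at_bot"
    unfolding at_right_MInf[symmetric] by (simp only: at_within_def)
  then show ?thesis
    unfolding isCont_def unfolding MInf
    using tendsto_logistic_at_bot by (simp only: filterlim_filtermap elogistic_simps)
qed

lemma continuous_on_elogistic [continuous_intros]:
  "continuous_on S f \<Longrightarrow> continuous_on S (\<lambda>s. elogistic (f s))"
  using continuous_on_compose2[of UNIV elogistic S f] isCont_elogistic
  by (simp add: continuous_at_imp_continuous_on)

text \<open>\<open>elogistic\<close> takes the values 0 and 1 only at the infinite points, so
  removing \<open>V_b\<close> keeps the image away from the zeros of
  \<open>cube_weight\<close>.\<close>

lemma sMutInf_Psi_extension:
  "continuous_on (UNIV - V_b)
    ((sMutInf \<circ> cube_table) \<circ> (\<lambda>(x, y, z). (elogistic x, elogistic y, elogistic z)))"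
proof (rule continuous_on_compose[OF _ continuous_on_subset[OF continuous_on_sMutInf_cube_table]])
  show "continuous_on (UNIV - V_b) (\<lambda>(x, y, z). (elogistic x, elogistic y, elogistic z))"
    unfolding split_beta by (intro continuous_intros)
  show "(\<lambda>(x, y, z). (elogistic x, elogistic y, elogistic z)) ` (UNIV - V_b) \<subseteq> cube_domain"
    using elogistic_bounds by (auto simp: cube_domain_iff V_b_def elogistic_eq_iff)
qed

theorem proposition8:
  shows
    "(\<forall>x::real. x \<noteq> 0 \<longrightarrow>
        (\<forall>p. local_extremum_at (sMutInf_at x) p \<longleftrightarrow> p = (0, 0)) \<and>
        (x > 0 \<longrightarrow> (\<forall>p. sMutInf_at x p \<le> sMutInf_at x (0, 0))) \<and>
        (x < 0 \<longrightarrow> (\<forall>p. sMutInf_at x (0, 0) \<le> sMutInf_at x p)) \<and>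
        (sMutInf_at x \<longlongrightarrow> 0) at_infinity)
     \<and> (\<forall>y z::real.
        ((\<lambda>x. sMutInf_at x (y, z)) \<longlongrightarrow>
           log 2 (exp (y + z) + 1) - exp (y + z) / (exp (y + z) + 1) * log 2 (exp (y + z))) at_top \<and>
        ((\<lambda>x. sMutInf_at x (y, z)) \<longlongrightarrow>
           - (log 2 (exp (y - z) + 1) - exp (y - z) / (exp (y - z) + 1) * log 2 (exp (y - z)))) at_bot \<and>
        (y = - z \<longrightarrow> ((\<lambda>x. sMutInf_at x (y, z)) \<longlongrightarrow> 1) at_top) \<and>
        (y = z \<longrightarrow> ((\<lambda>x. sMutInf_at x (y, z)) \<longlongrightarrow> - 1) at_bot))
     \<and> (\<exists>F :: ereal \<times> ereal \<times> ereal \<Rightarrow> real.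
        continuous_on (UNIV - V_b) F \<and>
        (\<forall>x y z. F (ereal x, ereal y, ereal z) = sMutInf (Psi (x, y, z))))
     \<and> (\<exists>G :: real ^ 2 ^ 2 \<Rightarrow> real.
        continuous_on (closure tables) G \<and> (\<forall>t\<in>tables. G t = sMutInf t))"
proof (intro conjI allI impI)
  show "((\<lambda>x. sMutInf_at x (y, z)) \<longlongrightarrow> 1) at_top" if "y = - z" for y z
    using sMutInf_at_tendsto_at_top[of y z] that by simp
  show "((\<lambda>x. sMutInf_at x (y, z)) \<longlongrightarrow> - 1) at_bot" if "y = z" for y z
    using sMutInf_at_tendsto_at_bot[of y z] that by simp
  show "\<exists>F :: ereal \<times> ereal \<times> ereal \<Rightarrow> real. continuous_on (UNIV - V_b) F \<and>
      (\<forall>x y z. F (ereal x, ereal y, ereal z) = sMutInf (Psi (x, y, z)))"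
    by (rule exI, rule conjI, rule sMutInf_Psi_extension) (simp add: cube_table_logistic)
  show "\<exists>G :: real ^ 2 ^ 2 \<Rightarrow> real.
      continuous_on (closure tables) G \<and> (\<forall>t\<in>tables. G t = sMutInf t)"
    \<comment> \<open>The witness is \<open>sMutInf\<close> itself: with \<open>ln 0 = 0\<close> its
      formula already gives the boundary values.\<close>
    using continuous_on_subset[OF continuous_on_sMutInf closure_tables_subset] by blast
qed (rule sMutInf_at_tendsto_at_top sMutInf_at_tendsto_at_bot sMutInf_at_tendsto_0
    local_extremum_at_sMutInf_at_iff sMutInf_at_le_origin sMutInf_at_ge_origin, assumption?)+

end
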